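(* Let $n\ge2$ and let $\psi:\mathbb{F}_{2^n}\to\mathbb{F}_{2^n}$ be the inversion map $\psi(x)=x^{2^n-2}$ (i.e. $\psi(x)=x^{-1}$ for $x\ne0$ and $\psi(0)=0$). Then for every $\rho\in\mathbb{F}_{2^n}\setminus\{0,1\}$, $$\bigl|\{\tau\in\mathbb{F}_{2^n}:\ \psi(\tau)+\psi(\tau+1)+\psi(\tau+\rho)=0\}\bigr|=1,$$ and consequently, for every $\rho\in\mathbb{F}_{2^n}\setminus\{0,1\}$, $$\sum_{t,a\in\mathbb{F}_{2^n}}\chi\bigl(\psi(t+\rho a)+\psi(t+a)+\psi(t)\bigr)=0.$$
   Context: $\mathbb{F}_{2^n}$ is the field with $2^n$ elements, $\operatorname{Tr}(x)=\sum_{i=0}^{n-1}x^{2^i}$ is the absolute trace, and $\chi(x)=(-1)^{\operatorname{Tr}(x)}$. *)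

theory Defs
  imports "HOL-Library.Cardinality" "HOL-Number_Theory.Residues"
begin

text \<open>
  The field with \<open>2 ^ n\<close> elements is a type \<open>'a :: finite_field\<close> with \<open>CARD('a) = 2 ^ n\<close>.
  The exponent \<open>n\<close> is an explicit argument of the definitions below, which are meaningful
  only under that equation.
\<close>

definition inversion_map :: "nat \<Rightarrow> 'a \<Rightarrow> 'a :: finite_field"
  where "inversion_map n x = x ^ (2 ^ n - 2)"

definition abs_trace :: "nat \<Rightarrow> 'a \<Rightarrow> 'a :: finite_field"
  where "abs_trace n x = (\<Sum>i<n. x ^ (2 ^ i))"

text \<open>
  The trace lies in the prime field \<open>{0, 1}\<close> (lemma \<open>abs_trace_cases\<close>), so that \<open>(-1) ^ Tr x\<close> is
  \<open>1\<close> for \<open>Tr x = 0\<close> and \<open>- 1\<close> for \<open>Tr x = 1\<close>.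
\<close>

definition add_char :: "nat \<Rightarrow> 'a :: finite_field \<Rightarrow> int"
  where "add_char n x = (if abs_trace n x = 0 then 1 else - 1)"

lemma two_eq_zero_card_power:
  assumes "card (UNIV :: 'a :: finite_field set) = 2 ^ n"
  shows "(2 :: 'a) = 0"
proof -
  have "(of_nat CARD('a) :: 'a) = 0"
    using CHAR_dvd_CARD of_nat_eq_0_iff_char_dvd by blast
  then show ?thesis
    using assms by simp
qed

lemma inversion_map_eq_inverse:
  fixes x :: "'a :: finite_field"
  assumes "CARD('a) = 2 ^ n" "n \<ge> 2"
  shows "inversion_map n x = inverse x"
proof (cases "x = 0")
  case False
  have le: "(2 :: nat) ^ 2 \<le> 2 ^ n"
    using assms(2) by (intro power_increasing) auto
  have "x ^ (2 ^ n - 2) * (x * x) = x ^ (2 ^ n - 2 + 2)"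
    by (simp add: power_add power2_eq_square)
  also have "2 ^ n - 2 + 2 = (2 :: nat) ^ n"
    using le by simp
  also have "x ^ (2 ^ n) = x"
    using finite_field_power_card_eq_same[of x] assms(1) by simp
  finally have "(x ^ (2 ^ n - 2) * x) * x = 1 * x"
    by (simp only: mult.assoc mult_1_left)
  then have "x ^ (2 ^ n - 2) * x = 1"
    using False by (simp only: mult_right_cancel[OF False])
  then show ?thesis
    using False by (simp add: inversion_map_def field_simps)
next
  case True
  have "(2 :: nat) ^ 2 \<le> 2 ^ n"
    using assms(2) by (intro power_increasing) auto
  then show ?thesis
    using True by (simp add: inversion_map_def)
qed

lemma abs_trace_cases:
  fixes x :: "'a :: finite_field"
  assumes "CARD('a) = 2 ^ n"
  shows "abs_trace n x = 0 \<or> abs_trace n x = 1"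
proof -
  note two = two_eq_zero_card_power[OF assms]
  have sq_add: "(a + b)\<^sup>2 = a\<^sup>2 + b\<^sup>2" for a b :: 'a
    by (simp add: power2_sum two)
  have sq_sum: "(\<Sum>i<m. x ^ (2 ^ i))\<^sup>2 = (\<Sum>i<m. x ^ (2 ^ Suc i))" for m
    by (induction m) (simp_all add: sq_add mult.commute flip: power_mult)
  have "(abs_trace n x)\<^sup>2 + x = (\<Sum>i<Suc n. x ^ (2 ^ i))"
    by (subst sum.lessThan_Suc_shift) (simp add: abs_trace_def sq_sum)
  also have "\<dots> = abs_trace n x + x"
    using finite_field_power_card_eq_same[of x] assms by (simp add: abs_trace_def)
  finally have "abs_trace n x * (abs_trace n x - 1) = 0"
    by (simp add: power2_eq_square algebra_simps)
  then show ?thesis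
    by simp
qed

lemma add_char_cases:
  fixes x :: "'a :: finite_field"
  assumes "CARD('a) = 2 ^ n"
  shows "abs_trace n x = 0 \<and> add_char n x = (- 1) ^ 0 \<or>
         abs_trace n x = 1 \<and> add_char n x = (- 1) ^ 1"
  using abs_trace_cases[OF assms, of x] by (auto simp: add_char_def)

end

theory Submission
  imports Defs "HOL-Computational_Algebra.Polynomial"
begin

text \<open>
  Away from \<open>0\<close>, \<open>1\<close>, \<open>\<rho>\<close>, clearing denominators in
  \<open>1/\<tau> + 1/(\<tau> + 1) + 1/(\<tau> + \<rho>) = 0\<close> leaves \<open>\<tau>\<^sup>2 = \<rho>\<close> in characteristic 2, which has exactly
  one solution because squaring is a bijection; the three excluded values are not solutions.
  For the character sum, the terms with \<open>a = 0\<close> add up to \<open>\<Sum>t. \<chi> (1/t) = 0\<close>. For \<open>a \<noteq> 0\<close>,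
  substitute \<open>t = a \<tau>\<close>: the argument of \<open>\<chi>\<close> becomes \<open>f \<tau> / a\<close>, where \<open>f \<tau>\<close> is the left-hand
  side above, and by orthogonality summing over \<open>a \<noteq> 0\<close> gives \<open>2 ^ n - 1\<close> at the only zero of
  \<open>f\<close> and \<open>- 1\<close> at each of the other \<open>2 ^ n - 1\<close> points.
\<close>

lemma char_two_add_eq_zero_iff:
  fixes x y :: "'a :: ring_1"
  assumes "(2 :: 'a) = 0"
  shows "x + y = 0 \<longleftrightarrow> x = y"
proof -
  have "y + y = 0"
    using assms by (metis mult_2 mult_zero_left)
  then show ?thesis
    by (metis add_right_cancel)
qed

text \<open>Iterated Frobenius: \<open>i = 1\<close> serves the injectivity of squaring, general
  \<open>i\<close> the additivity of the trace.\<close>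

lemma char_two_add_power_two_power:
  fixes x y :: "'a :: comm_ring_1"
  assumes "(2 :: 'a) = 0"
  shows "(x + y) ^ (2 ^ i) = x ^ (2 ^ i) + y ^ (2 ^ i)"
proof (induction i)
  case (Suc i)
  have "(x + y) ^ (2 ^ Suc i) = ((x + y) ^ (2 ^ i))\<^sup>2"
    by (simp add: mult.commute flip: power_mult)
  also have "\<dots> = (x ^ (2 ^ i))\<^sup>2 + (y ^ (2 ^ i))\<^sup>2"
    by (simp add: Suc.IH power2_sum assms)
  finally show ?case
    by (simp add: mult.commute flip: power_mult)
qed simp

text \<open>Squaring is additive with trivial kernel, hence injective, and finiteness makes it
  onto.\<close>

lemma char_two_bij_square:
  assumes "(2 :: 'a :: {finite, idom}) = 0"
  shows "bij (\<lambda>x :: 'a. x\<^sup>2)"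
proof -
  have "inj (\<lambda>x :: 'a. x\<^sup>2)"
  proof (rule injI)
    fix x y :: 'a
    assume "x\<^sup>2 = y\<^sup>2"
    then have "(x + y)\<^sup>2 = 0"
      using char_two_add_power_two_power[OF assms, of x y 1]
        char_two_add_eq_zero_iff[OF assms, of "x\<^sup>2" "y\<^sup>2"] by simp
    then show "x = y"
      using char_two_add_eq_zero_iff[OF assms] by simp
  qed
  then show ?thesis
    by (simp add: bij_def finite_UNIV_inj_surj)
qed

lemma char_two_sum_inverses_eq_zero_iff:
  fixes \<rho> \<tau> :: "'a :: field"
  assumes two: "(2 :: 'a) = 0" and \<rho>: "\<rho> \<noteq> 0" "\<rho> \<noteq> 1"
  shows "inverse \<tau> + inverse (\<tau> + 1) + inverse (\<tau> + \<rho>) = 0 \<longleftrightarrow> \<tau>\<^sup>2 = \<rho>"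
proof -
  note add0 = char_two_add_eq_zero_iff[OF two]
  have self: "x + x = 0" for x :: 'a
    by (subst add0) (rule refl)
  consider "\<tau> = 0" | "\<tau> = 1" | "\<tau> = \<rho>" | "\<tau> \<noteq> 0" "\<tau> \<noteq> 1" "\<tau> \<noteq> \<rho>"
    by blast
  then show ?thesis
  proof cases
    \<comment> \<open>At each of the three poles \<open>inverse 0 = 0\<close> removes one term, and
      \<open>\<rho> \<noteq> 0\<close>, \<open>\<rho> \<noteq> 1\<close> make both sides
      false.\<close>
    case 1
    then show ?thesis
      using \<rho> by (auto simp: add0)
  next
    case 2
    then show ?thesis
      using \<rho> self[of 1] by (auto simp: add0 eq_commute[of 1])
  next
    case 3
    have "inverse \<rho> \<noteq> inverse (\<rho> + 1)"
      by simp
    moreover have "\<rho>\<^sup>2 \<noteq> \<rho>"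
      using \<rho> by (simp add: power2_eq_square)
    ultimately show ?thesis
      using 3 by (simp add: two add0)
  next
    case 4
    then have nz: "\<tau> + 1 \<noteq> 0" "\<tau> + \<rho> \<noteq> 0"
      by (simp_all add: add0)
    \<comment> \<open>The identity holds in every characteristic; the even part of the numerator is
      split off so that \<open>two\<close> can delete it.\<close>
    have "inverse \<tau> + inverse (\<tau> + 1) + inverse (\<tau> + \<rho>) =
        (\<tau>\<^sup>2 + \<rho> + 2 * (\<tau>\<^sup>2 + \<tau> + \<rho> * \<tau>)) / (\<tau> * (\<tau> + 1) * (\<tau> + \<rho>))"
      using 4 nz by (simp add: divide_simps) (simp add: algebra_simps power2_eq_square)
    then show ?thesis
      using 4 nz by (simp add: two add0)
  qed
qed

lemma abs_trace_add:
  fixes x y :: "'a :: finite_field"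
  assumes "CARD('a) = 2 ^ n"
  shows "abs_trace n (x + y) = abs_trace n x + abs_trace n y"
  using char_two_add_power_two_power[OF two_eq_zero_card_power[OF assms]]
  by (simp add: abs_trace_def sum.distrib)

text \<open>The trace is a polynomial function of degree \<open>2 ^ (n - 1)\<close>, hence has a non-root.\<close>

lemma abs_trace_surj_one:
  assumes card: "CARD('a) = 2 ^ n"
  obtains u :: "'a :: finite_field" where "abs_trace n u = 1"
proof -
  have "n \<noteq> 0"
  proof
    assume "n = 0"
    then have "card {0, 1 :: 'a} \<le> 1"
      using card card_mono[of UNIV "{0, 1 :: 'a}"] by simp
    then show False by simp
  qed
  define p :: "'a poly" where "p = (\<Sum>i<n. monom 1 (2 ^ i))"
  have poly_p: "poly p x = abs_trace n x" for x
    by (simp add: p_def abs_trace_def poly_sum poly_monom)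
  \<comment> \<open>Only \<open>i = 0\<close> has \<open>2 ^ i = 1\<close>, so the linear
    coefficient shows that \<open>p\<close> is nonzero.\<close>
  have "coeff p 1 = (\<Sum>i<n. if i = 0 then 1 else 0)"
    unfolding p_def by (simp add: coeff_sum)
  also have "\<dots> = 1"
    using \<open>n \<noteq> 0\<close> by simp
  finally have "p \<noteq> 0"
    by auto
  have "degree p \<le> 2 ^ (n - 1)"
    unfolding p_def
    by (intro degree_sum_le order.trans[OF degree_monom_le] power_increasing) auto
  also have "\<dots> < (2 :: nat) ^ n"
    using \<open>n \<noteq> 0\<close> by simp
  finally have "card {x. poly p x = 0} < CARD('a)"
    using card_poly_roots_bound[OF \<open>p \<noteq> 0\<close>] card by linarith
  then have "{x. poly p x = 0} \<noteq> UNIV"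
    by (metis less_irrefl)
  then obtain u :: 'a where "abs_trace n u \<noteq> 0"
    by (auto simp: poly_p)
  then show thesis
    using abs_trace_cases[OF card, of u] that by blast
qed

lemma add_char_zero [simp]: "add_char n 0 = 1"
  by (simp add: add_char_def abs_trace_def zero_power)

lemma add_char_add:
  fixes x y :: "'a :: finite_field"
  assumes "CARD('a) = 2 ^ n"
  shows "add_char n (x + y) = add_char n x * add_char n y"
  using abs_trace_cases[OF assms, of x] abs_trace_cases[OF assms, of y]
    two_eq_zero_card_power[OF assms]
  by (auto simp: add_char_def abs_trace_add[OF assms])

text \<open>Translating by an element of trace 1 flips the sign of every term, so the sum is its own
  negative.\<close>

lemma sum_add_char:
  assumes card: "card (UNIV :: 'a :: finite_field set) = 2 ^ n"
  shows "(\<Sum>x :: 'a\<in>UNIV. add_char n x) = 0"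
proof -
  obtain u :: 'a where u: "abs_trace n u = 1"
    using abs_trace_surj_one[OF card] .
  have "(\<Sum>x :: 'a\<in>UNIV. add_char n x) = (\<Sum>x\<in>UNIV. add_char n (x + u))"
    by (rule sum.reindex_bij_betw[symmetric]) (rule bij_plus_right)
  also have "\<dots> = - (\<Sum>x :: 'a\<in>UNIV. add_char n x)"
    by (simp add: add_char_add[OF card] add_char_def[of n u] u sum_negf)
  finally show ?thesis
    by simp
qed

lemma bij_inverse_field: "bij (inverse :: 'a :: field \<Rightarrow> 'a)"
  by (rule o_bij[of inverse]) auto

lemma bij_mult_right_field:
  fixes c :: "'a :: field"
  assumes "c \<noteq> 0"
  shows "bij (\<lambda>x. x * c)"
  by (rule o_bij[of "\<lambda>x. x / c"]) (use assms in auto)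

lemma sum_add_char_inverse:
  assumes "card (UNIV :: 'a :: finite_field set) = 2 ^ n"
  shows "(\<Sum>x :: 'a\<in>UNIV. add_char n (inverse x)) = 0"
  using sum.reindex_bij_betw[OF bij_inverse_field, of "add_char n :: 'a \<Rightarrow> int"] sum_add_char[OF assms]
  by simp

text \<open>Orthogonality: since \<open>inverse 0 = 0\<close>, \<open>inverse\<close> permutes the
  whole field, and so does multiplication by \<open>c\<close> when
  \<open>c \<noteq> 0\<close>.\<close>

lemma sum_add_char_inverse_mult:
  fixes c :: "'a :: finite_field"
  assumes "CARD('a) = 2 ^ n"
  shows "(\<Sum>a\<in>UNIV. add_char n (inverse a * c)) = (if c = 0 then 2 ^ n else 0)"
proof (cases "c = 0")
  case True
  then show ?thesis
    using assms by simp
next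
  case False
  have "(\<Sum>a\<in>UNIV. add_char n (inverse a * c)) = (\<Sum>x :: 'a\<in>UNIV. add_char n (x * c))"
    by (rule sum.reindex_bij_betw[OF bij_inverse_field])
  also have "\<dots> = (\<Sum>x :: 'a\<in>UNIV. add_char n x)"
    by (rule sum.reindex_bij_betw[OF bij_mult_right_field[OF False]])
  finally show ?thesis
    using False sum_add_char[OF assms] by simp
qed

lemma card_zeros_sum_inverses:
  fixes \<rho> :: "'a :: finite_field"
  assumes "CARD('a) = 2 ^ n" "\<rho> \<noteq> 0" "\<rho> \<noteq> 1"
  shows "card {\<tau>. inverse \<tau> + inverse (\<tau> + 1) + inverse (\<tau> + \<rho>) = 0} = 1"
proof -
  note two = two_eq_zero_card_power[OF assms(1)]
  have "\<exists>!\<tau>. \<tau>\<^sup>2 = \<rho>"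
    using char_two_bij_square[OF two] unfolding bij_iff by blast
  then obtain \<sigma> where "{\<tau>. \<tau>\<^sup>2 = \<rho>} = {\<sigma>}"
    by blast
  then show ?thesis
    by (simp add: char_two_sum_inverses_eq_zero_iff[OF two assms(2,3)])
qed

lemma sum_add_char_sum_inverses:
  fixes \<rho> :: "'a :: finite_field"
  assumes card: "CARD('a) = 2 ^ n" and \<rho>: "\<rho> \<noteq> 0" "\<rho> \<noteq> 1"
  shows "(\<Sum>t\<in>UNIV. \<Sum>a\<in>UNIV.
    add_char n (inverse (t + \<rho> * a) + inverse (t + a) + inverse t)) = 0"
proof -
  define f where "f \<tau> = inverse \<tau> + inverse (\<tau> + 1) + inverse (\<tau> + \<rho>)" for \<tau>
  define G where "G a = (\<Sum>t\<in>UNIV.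
    add_char n (inverse (t + \<rho> * a) + inverse (t + a) + inverse t))" for a
  \<comment> \<open>For \<open>a = 0\<close> the argument is \<open>3 * inverse t\<close>, which is
    \<open>inverse t\<close> in characteristic 2.\<close>
  have "(3 :: 'a) = 2 + 1"
    by simp
  then have "(3 :: 'a) = 1"
    by (simp only: two_eq_zero_card_power[OF card] add_0_left)
  then have G_0: "G 0 = 0"
    by (simp add: G_def sum_add_char_inverse[OF card])
  have G_nz: "G a = (\<Sum>\<tau>\<in>UNIV. add_char n (inverse a * f \<tau>))" if "a \<noteq> 0" for a
  proof -
    have scale: "inverse (\<tau> * a + \<rho> * a) + inverse (\<tau> * a + a) + inverse (\<tau> * a) =
        inverse a * f \<tau>" for \<tau>
    proof -
      have "\<tau> * a + \<rho> * a = (\<tau> + \<rho>) * a" "\<tau> * a + a = (\<tau> + 1) * a"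
        by (simp_all add: distrib_right)
      \<comment> \<open>\<open>inverse_mult_distrib\<close> also covers zero factors, so the poles
        of \<open>f\<close> need no separate treatment.\<close>
      then show ?thesis
        by (simp only: f_def inverse_mult_distrib) (simp add: algebra_simps)
    qed
    have "G a = (\<Sum>\<tau>\<in>UNIV.
        add_char n (inverse (\<tau> * a + \<rho> * a) + inverse (\<tau> * a + a) + inverse (\<tau> * a)))"
      unfolding G_def by (rule sum.reindex_bij_betw[OF bij_mult_right_field[OF that], symmetric])
    also have "\<dots> = (\<Sum>\<tau>\<in>UNIV. add_char n (inverse a * f \<tau>))"
      by (simp only: scale)
    finally show ?thesis .
  qed
  have "(\<Sum>t\<in>UNIV. \<Sum>a\<in>UNIV.
      add_char n (inverse (t + \<rho> * a) + inverse (t + a) + inverse t)) = (\<Sum>a\<in>UNIV. G a)"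
    unfolding G_def by (rule sum.swap)
  also have "\<dots> = (\<Sum>a\<in>UNIV - {0}. \<Sum>\<tau>\<in>UNIV. add_char n (inverse a * f \<tau>))"
    by (subst sum.remove[of UNIV 0]) (simp_all add: G_0 G_nz)
  \<comment> \<open>The term for \<open>a = 0\<close> is put back so that orthogonality applies; as
    \<open>inverse 0 = 0\<close>, it is a sum of \<open>2 ^ n\<close> ones.\<close>
  also have "\<dots> = (\<Sum>a\<in>UNIV. \<Sum>\<tau>\<in>UNIV. add_char n (inverse a * f \<tau>)) - 2 ^ n"
    using card by (simp add: sum_diff1)
  also have "(\<Sum>a\<in>UNIV. \<Sum>\<tau>\<in>UNIV. add_char n (inverse a * f \<tau>)) =
      (\<Sum>\<tau>\<in>UNIV. \<Sum>a\<in>UNIV. add_char n (inverse a * f \<tau>))"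
    by (rule sum.swap)
  also have "\<dots> = 2 ^ n * int (card {\<tau>. f \<tau> = 0})"
    by (simp add: sum_add_char_inverse_mult[OF card] flip: sum.inter_filter)
  also have "card {\<tau>. f \<tau> = 0} = 1"
    unfolding f_def by (rule card_zeros_sum_inverses[OF card \<rho>])
  finally show ?thesis
    by simp
qed

theorem theorem9p3:
  fixes n :: nat
  assumes "n \<ge> 2" and "card (UNIV :: 'a :: finite_field set) = 2 ^ n"
  shows "(\<forall>\<rho> \<in> UNIV - {0, 1 :: 'a}.
            card {\<tau>. inversion_map n \<tau> + inversion_map n (\<tau> + 1) + inversion_map n (\<tau> + \<rho>) = 0} = 1) \<and>
         (\<forall>\<rho> \<in> UNIV - {0, 1 :: 'a}.
            (\<Sum>t\<in>UNIV. \<Sum>a\<in>UNIV.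
               add_char n (inversion_map n (t + \<rho> * a) + inversion_map n (t + a) + inversion_map n t)) = 0)"
  \<comment> \<open>As \<open>n \<ge> 2\<close>, the exponent \<open>2 ^ n - 2\<close> is positive,
    so \<open>inversion_map n\<close> agrees with \<open>inverse\<close> at 0 too.\<close>
  using card_zeros_sum_inverses[OF assms(2)] sum_add_char_sum_inverses[OF assms(2)]
  by (simp add: inversion_map_eq_inverse[OF assms(2,1)])

end
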